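(* Let $\mathbb{A}$ be a symmetric strict monoidal category and let $\mathbf{H}\,\mathcal{C}(\mathbb{A})$ be the strict monoidal category of horizontal cells of its free cornering. For any objects $A,B$ of $\mathbb{A}$, the following isomorphisms exist in $\mathbf{H}\,\mathcal{C}(\mathbb{A})$: 1. $I^\circ\cong I\cong I^\bullet$; 2. $A^\circ\otimes B^\circ\cong B^\circ\otimes A^\circ$ and $A^\bullet\otimes B^\bullet\cong B^\bullet\otimes A^\bullet$; 3. $(A\otimes B)^\circ\cong A^\circ\otimes B^\circ$ and $(A\otimes B)^\bullet\cong A^\bullet\otimes B^\bullet$. (In 1, $I^\circ$ and $I^\bullet$ are the generators associated with the unit object of $\mathbb{A}$, and the middle $I$ is the monoidal unit of $\mathbf{H}\,\mathcal{C}(\mathbb{A})$, i.e. the empty word.)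
   Context: Single-object double categories. A single-object double category $\mathbb{D}$ consists of a monoid $(\mathbb{D}_H,\otimes,I)$ of horizontal edges, a monoid $(\mathbb{D}_V,\otimes,I)$ of vertical edges, and cells $\alpha$, each with a top and a bottom boundary in $\mathbb{D}_H$ and a left and a right boundary in $\mathbb{D}_V$. If the right boundary of $\alpha$ equals the left boundary of $\beta$ there is a horizontal composite $\alpha\vert\beta$ (top/bottom boundaries are multiplied in the order $\alpha,\beta$; left boundary that of $\alpha$, right boundary that of $\beta$). If the bottom boundary of $\alpha$ equals the top boundary of $\beta$ there is a vertical composite $\frac{\alpha}{\beta}$ (left/right boundaries multiplied in the order $\alpha,\beta$; top that of $\alpha$, bottom that of $\beta$). Both compositions are associative and unital, with identity cells $1_A$ for $A\in\mathbb{D}_H$ (top $=$ bottom $=A$, left $=$ right $=I$; identities for vertical composition) and $1_X$ for $X\in\mathbb{D}_V$ (left $=$ right $=X$, top $=$ bottom $=I$; identities for horizontal composition), with $1_A\vert 1_B=1_{A\otimes B}$, $\frac{1_X}{1_Y}=1_{X\otimes Y}$, the two identity cells on $I$ coincide, and the interchange law $\frac{\alpha}{\beta}\big\vert\frac{\gamma}{\delta}=\frac{\alpha\vert\gamma}{\beta\vert\delta}$ holds. Horizontal cells. $\mathbf{H}\mathbb{D}$ is the strict monoidal category with object set $\mathbb{D}_V$, whose morphisms $X\to Y$ are cells with left boundary $X$, right boundary $Y$ and top and bottom boundary $I$; composition is horizontal composition, and the tensor product is vertical composition, $h\otimes k=\frac{h}{k}$. Free cornering. For a symmetric strict monoidal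 category $\mathbb{A}$ (with object set $\mathbb{A}_0$), $\mathcal{C}(\mathbb{A})$ is the free single-object double category determined by: horizontal edge monoid $(\mathbb{A}_0,\otimes,I)$; vertical edge monoid the free monoid $\mathbb{A}^{\circ\bullet}=(\mathbb{A}_0\times\{\circ,\bullet\})^*$, with generators written $A^\circ$, $A^\bullet$, product written $\otimes$ and unit $I$; generating cells, for each $A\in\mathbb{A}_0$, the corners (boundaries not mentioned are $I$) - $s^\circ_A$: top $A$, right $A^\circ$; $\quad r^\circ_A$: left $A^\circ$, bottom $A$; - $s^\bullet_A$: top $A$, left $A^\bullet$; $\quad r^\bullet_A$: right $A^\bullet$, bottom $A$; and, for each morphism $f:A\to B$ of $\mathbb{A}$, a cell $\ulcorner f\urcorner$ with top $A$, bottom $B$; subject to the yanking equations $s^\circ_A\vert r^\circ_A=1_A$, $\frac{r^\circ_A}{s^\circ_A}=1_{A^\circ}$, $r^\bullet_A\vert s^\bullet_A=1_A$, $\frac{r^\bullet_A}{s^\bullet_A}=1_{A^\bullet}$, and the equations $\frac{\ulcorner f\urcorner}{\ulcorner g\urcorner}=\ulcorner f;g\urcorner$ (for composable $f,g$; $f;g$ is "first $f$ then $g$"), $\ulcorner 1_A\urcorner=1_A$, $\ulcorner f\urcorner\vert\ulcorner g\urcorner=\ulcorner f\otimes g\urcorner$. *)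

theory Defs
  imports "HOL-Algebra.Group"
begin

section \<open>Strict monoidal categories\<close>

text \<open>Composition is written in diagrammatic order: \<open>cmp C f g\<close> is first \<open>f\<close>, then \<open>g\<close>.
  The tensor product of objects is the multiplication of the monoid \<open>ob C\<close>.\<close>

record ('o, 'm) smcat =
  ob :: "'o monoid"
  arr :: "'m set"
  src :: "'m \<Rightarrow> 'o"
  tgt :: "'m \<Rightarrow> 'o"
  idt :: "'o \<Rightarrow> 'm"
  cmp :: "'m \<Rightarrow> 'm \<Rightarrow> 'm"
  ten :: "'m \<Rightarrow> 'm \<Rightarrow> 'm"

locale strict_monoidal_category =
  fixes C :: "('o, 'm, 'z) smcat_scheme"
  assumes ob_monoid: "monoid (ob C)"
    and src_closed: "f \<in> arr C \<Longrightarrow> src C f \<in> carrier (ob C)"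
    and tgt_closed: "f \<in> arr C \<Longrightarrow> tgt C f \<in> carrier (ob C)"
    and idt_closed: "X \<in> carrier (ob C) \<Longrightarrow> idt C X \<in> arr C"
    and src_idt: "X \<in> carrier (ob C) \<Longrightarrow> src C (idt C X) = X"
    and tgt_idt: "X \<in> carrier (ob C) \<Longrightarrow> tgt C (idt C X) = X"
    and cmp_closed: "\<lbrakk>f \<in> arr C; g \<in> arr C; tgt C f = src C g\<rbrakk> \<Longrightarrow> cmp C f g \<in> arr C"
    and src_cmp: "\<lbrakk>f \<in> arr C; g \<in> arr C; tgt C f = src C g\<rbrakk> \<Longrightarrow> src C (cmp C f g) = src C f"
    and tgt_cmp: "\<lbrakk>f \<in> arr C; g \<in> arr C; tgt C f = src C g\<rbrakk> \<Longrightarrow> tgt C (cmp C f g) = tgt C g"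
    and cmp_assoc: "\<lbrakk>f \<in> arr C; g \<in> arr C; h \<in> arr C; tgt C f = src C g; tgt C g = src C h\<rbrakk>
        \<Longrightarrow> cmp C (cmp C f g) h = cmp C f (cmp C g h)"
    and idt_cmp: "f \<in> arr C \<Longrightarrow> cmp C (idt C (src C f)) f = f"
    and cmp_idt: "f \<in> arr C \<Longrightarrow> cmp C f (idt C (tgt C f)) = f"
    and ten_closed: "\<lbrakk>f \<in> arr C; g \<in> arr C\<rbrakk> \<Longrightarrow> ten C f g \<in> arr C"
    and src_ten: "\<lbrakk>f \<in> arr C; g \<in> arr C\<rbrakk> \<Longrightarrow> src C (ten C f g) = src C f \<otimes>\<^bsub>ob C\<^esub> src C g"
    and tgt_ten: "\<lbrakk>f \<in> arr C; g \<in> arr C\<rbrakk> \<Longrightarrow> tgt C (ten C f g) = tgt C f \<otimes>\<^bsub>ob C\<^esub> tgt C g"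
    and ten_idt: "\<lbrakk>X \<in> carrier (ob C); Y \<in> carrier (ob C)\<rbrakk>
        \<Longrightarrow> ten C (idt C X) (idt C Y) = idt C (X \<otimes>\<^bsub>ob C\<^esub> Y)"
    and ten_cmp: "\<lbrakk>f \<in> arr C; f' \<in> arr C; g \<in> arr C; g' \<in> arr C; tgt C f = src C f'; tgt C g = src C g'\<rbrakk>
        \<Longrightarrow> ten C (cmp C f f') (cmp C g g') = cmp C (ten C f g) (ten C f' g')"
    and ten_assoc: "\<lbrakk>f \<in> arr C; g \<in> arr C; h \<in> arr C\<rbrakk> \<Longrightarrow> ten C (ten C f g) h = ten C f (ten C g h)"
    and unit_ten: "f \<in> arr C \<Longrightarrow> ten C (idt C \<one>\<^bsub>ob C\<^esub>) f = f"
    and ten_unit: "f \<in> arr C \<Longrightarrow> ten C f (idt C \<one>\<^bsub>ob C\<^esub>) = f"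

definition isomorphic_objects :: "('o, 'm, 'z) smcat_scheme \<Rightarrow> 'o \<Rightarrow> 'o \<Rightarrow> bool" where
  "isomorphic_objects C X Y \<longleftrightarrow>
     X \<in> carrier (ob C) \<and> Y \<in> carrier (ob C) \<and>
     (\<exists>f\<in>arr C. \<exists>g\<in>arr C.
        src C f = X \<and> tgt C f = Y \<and> src C g = Y \<and> tgt C g = X \<and>
        cmp C f g = idt C X \<and> cmp C g f = idt C Y)"

record ('o, 'm) ssmcat = "('o, 'm) smcat" +
  braid :: "'o \<Rightarrow> 'o \<Rightarrow> 'm"

locale symmetric_strict_monoidal_category = strict_monoidal_category C
  for C :: "('o, 'm, 'z) ssmcat_scheme" +
  assumes braid_closed: "\<lbrakk>X \<in> carrier (ob C); Y \<in> carrier (ob C)\<rbrakk> \<Longrightarrow> braid C X Y \<in> arr C"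
    and src_braid: "\<lbrakk>X \<in> carrier (ob C); Y \<in> carrier (ob C)\<rbrakk>
        \<Longrightarrow> src C (braid C X Y) = X \<otimes>\<^bsub>ob C\<^esub> Y"
    and tgt_braid: "\<lbrakk>X \<in> carrier (ob C); Y \<in> carrier (ob C)\<rbrakk>
        \<Longrightarrow> tgt C (braid C X Y) = Y \<otimes>\<^bsub>ob C\<^esub> X"
    and braid_natural: "\<lbrakk>f \<in> arr C; g \<in> arr C\<rbrakk>
        \<Longrightarrow> cmp C (ten C f g) (braid C (tgt C f) (tgt C g))
            = cmp C (braid C (src C f) (src C g)) (ten C g f)"
    and braid_symmetric: "\<lbrakk>X \<in> carrier (ob C); Y \<in> carrier (ob C)\<rbrakk>
        \<Longrightarrow> cmp C (braid C X Y) (braid C Y X) = idt C (X \<otimes>\<^bsub>ob C\<^esub> Y)"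
    and braid_hexagon: "\<lbrakk>X \<in> carrier (ob C); Y \<in> carrier (ob C); Z \<in> carrier (ob C)\<rbrakk>
        \<Longrightarrow> braid C X (Y \<otimes>\<^bsub>ob C\<^esub> Z)
            = cmp C (ten C (braid C X Y) (idt C Z)) (ten C (idt C Y) (braid C X Z))"


section \<open>Single-object double categories\<close>

text \<open>\<open>hcomp D \<alpha> \<beta>\<close> is \<open>\<alpha>\<close> beside (to the left of) \<open>\<beta>\<close>, and \<open>vcomp D \<alpha> \<beta>\<close> is \<open>\<alpha>\<close> above \<open>\<beta>\<close>.
  \<open>hid D A\<close> is the cell \<open>1\<^sub>A\<close> on a horizontal edge, an identity for vertical composition;
  \<open>vid D X\<close> is the cell \<open>1\<^sub>X\<close> on a vertical edge, an identity for horizontal composition.\<close>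

record ('h, 'v, 'c) sodcat =
  hedge :: "'h monoid"
  vedge :: "'v monoid"
  cells :: "'c set"
  ctop :: "'c \<Rightarrow> 'h"
  cbot :: "'c \<Rightarrow> 'h"
  cleft :: "'c \<Rightarrow> 'v"
  cright :: "'c \<Rightarrow> 'v"
  hcomp :: "'c \<Rightarrow> 'c \<Rightarrow> 'c"
  vcomp :: "'c \<Rightarrow> 'c \<Rightarrow> 'c"
  hid :: "'h \<Rightarrow> 'c"
  vid :: "'v \<Rightarrow> 'c"

locale single_object_double_category =
  fixes D :: "('h, 'v, 'c, 'z) sodcat_scheme"
  assumes hedge_monoid: "monoid (hedge D)"
    and vedge_monoid: "monoid (vedge D)"
    and bound_closed: "\<alpha> \<in> cells D \<Longrightarrow>
          ctop D \<alpha> \<in> carrier (hedge D) \<and> cbot D \<alpha> \<in> carrier (hedge D) \<and>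
          cleft D \<alpha> \<in> carrier (vedge D) \<and> cright D \<alpha> \<in> carrier (vedge D)"
    and hcomp_cell: "\<lbrakk>\<alpha> \<in> cells D; \<beta> \<in> cells D; cright D \<alpha> = cleft D \<beta>\<rbrakk> \<Longrightarrow>
          hcomp D \<alpha> \<beta> \<in> cells D \<and>
          ctop D (hcomp D \<alpha> \<beta>) = ctop D \<alpha> \<otimes>\<^bsub>hedge D\<^esub> ctop D \<beta> \<and>
          cbot D (hcomp D \<alpha> \<beta>) = cbot D \<alpha> \<otimes>\<^bsub>hedge D\<^esub> cbot D \<beta> \<and>
          cleft D (hcomp D \<alpha> \<beta>) = cleft D \<alpha> \<and>
          cright D (hcomp D \<alpha> \<beta>) = cright D \<beta>"
    and vcomp_cell: "\<lbrakk>\<alpha> \<in> cells D; \<beta> \<in> cells D; cbot D \<alpha> = ctop D \<beta>\<rbrakk> \<Longrightarrow>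
          vcomp D \<alpha> \<beta> \<in> cells D \<and>
          ctop D (vcomp D \<alpha> \<beta>) = ctop D \<alpha> \<and>
          cbot D (vcomp D \<alpha> \<beta>) = cbot D \<beta> \<and>
          cleft D (vcomp D \<alpha> \<beta>) = cleft D \<alpha> \<otimes>\<^bsub>vedge D\<^esub> cleft D \<beta> \<and>
          cright D (vcomp D \<alpha> \<beta>) = cright D \<alpha> \<otimes>\<^bsub>vedge D\<^esub> cright D \<beta>"
    and hid_cell: "A \<in> carrier (hedge D) \<Longrightarrow>
          hid D A \<in> cells D \<and> ctop D (hid D A) = A \<and> cbot D (hid D A) = A \<and>
          cleft D (hid D A) = \<one>\<^bsub>vedge D\<^esub> \<and> cright D (hid D A) = \<one>\<^bsub>vedge D\<^esub>"
    and vid_cell: "X \<in> carrier (vedge D) \<Longrightarrow>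
          vid D X \<in> cells D \<and> ctop D (vid D X) = \<one>\<^bsub>hedge D\<^esub> \<and> cbot D (vid D X) = \<one>\<^bsub>hedge D\<^esub> \<and>
          cleft D (vid D X) = X \<and> cright D (vid D X) = X"
    and hcomp_assoc: "\<lbrakk>\<alpha> \<in> cells D; \<beta> \<in> cells D; \<gamma> \<in> cells D;
            cright D \<alpha> = cleft D \<beta>; cright D \<beta> = cleft D \<gamma>\<rbrakk> \<Longrightarrow>
          hcomp D (hcomp D \<alpha> \<beta>) \<gamma> = hcomp D \<alpha> (hcomp D \<beta> \<gamma>)"
    and vcomp_assoc: "\<lbrakk>\<alpha> \<in> cells D; \<beta> \<in> cells D; \<gamma> \<in> cells D;
            cbot D \<alpha> = ctop D \<beta>; cbot D \<beta> = ctop D \<gamma>\<rbrakk> \<Longrightarrow>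
          vcomp D (vcomp D \<alpha> \<beta>) \<gamma> = vcomp D \<alpha> (vcomp D \<beta> \<gamma>)"
    and hcomp_vid_left: "\<alpha> \<in> cells D \<Longrightarrow> hcomp D (vid D (cleft D \<alpha>)) \<alpha> = \<alpha>"
    and hcomp_vid_right: "\<alpha> \<in> cells D \<Longrightarrow> hcomp D \<alpha> (vid D (cright D \<alpha>)) = \<alpha>"
    and vcomp_hid_top: "\<alpha> \<in> cells D \<Longrightarrow> vcomp D (hid D (ctop D \<alpha>)) \<alpha> = \<alpha>"
    and vcomp_hid_bot: "\<alpha> \<in> cells D \<Longrightarrow> vcomp D \<alpha> (hid D (cbot D \<alpha>)) = \<alpha>"
    and hcomp_hid: "\<lbrakk>A \<in> carrier (hedge D); B \<in> carrier (hedge D)\<rbrakk> \<Longrightarrow>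
          hcomp D (hid D A) (hid D B) = hid D (A \<otimes>\<^bsub>hedge D\<^esub> B)"
    and vcomp_vid: "\<lbrakk>X \<in> carrier (vedge D); Y \<in> carrier (vedge D)\<rbrakk> \<Longrightarrow>
          vcomp D (vid D X) (vid D Y) = vid D (X \<otimes>\<^bsub>vedge D\<^esub> Y)"
    and hid_vid_unit: "hid D \<one>\<^bsub>hedge D\<^esub> = vid D \<one>\<^bsub>vedge D\<^esub>"
    and interchange: "\<lbrakk>\<alpha> \<in> cells D; \<beta> \<in> cells D; \<gamma> \<in> cells D; \<delta> \<in> cells D;
            cbot D \<alpha> = ctop D \<beta>; cbot D \<gamma> = ctop D \<delta>;
            cright D \<alpha> = cleft D \<gamma>; cright D \<beta> = cleft D \<delta>\<rbrakk> \<Longrightarrow>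
          hcomp D (vcomp D \<alpha> \<beta>) (vcomp D \<gamma> \<delta>) = vcomp D (hcomp D \<alpha> \<gamma>) (hcomp D \<beta> \<delta>)"

definition horizontal_cells :: "('h, 'v, 'c, 'z) sodcat_scheme \<Rightarrow> ('v, 'c) smcat" where
  "horizontal_cells D =
     \<lparr> ob = vedge D,
       arr = {\<alpha> \<in> cells D. ctop D \<alpha> = \<one>\<^bsub>hedge D\<^esub> \<and> cbot D \<alpha> = \<one>\<^bsub>hedge D\<^esub>},
       src = cleft D,
       tgt = cright D,
       idt = vid D,
       cmp = hcomp D,
       ten = vcomp D \<rparr>"

lemma (in single_object_double_category) strict_monoidal_category_horizontal_cells:
  "strict_monoidal_category (horizontal_cells D)"
proof -
  interpret H: monoid "hedge D" by (rule hedge_monoid)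
  interpret V: monoid "vedge D" by (rule vedge_monoid)
  show ?thesis
    by unfold_locales
      (auto simp: horizontal_cells_def bound_closed hcomp_cell vcomp_cell vid_cell hcomp_assoc
        vcomp_assoc hcomp_vid_left hcomp_vid_right vcomp_vid interchange V.m_assoc,
       (metis hid_vid_unit vcomp_hid_top vcomp_hid_bot)+)
qed


section \<open>The free cornering\<close>

datatype polarity = Circ | Bullet

definition word_monoid :: "'a set \<Rightarrow> 'a list monoid" where
  "word_monoid S = \<lparr>carrier = lists S, mult = (@), one = []\<rparr>"

abbreviation gen_circ :: "'o \<Rightarrow> ('o \<times> polarity) list" where
  "gen_circ A \<equiv> [(A, Circ)]"

abbreviation gen_bullet :: "'o \<Rightarrow> ('o \<times> polarity) list" where
  "gen_bullet A \<equiv> [(A, Bullet)]"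

text \<open>The free cornering is presented by generators and relations: its cells are the well-formed
  formal composites below, modulo the congruence \<open>cell_eq\<close> generated by the laws of a single-object
  double category and the relations of the free cornering. \<open>S_circ A\<close> stands for the corner
  \<open>s\<close> with superscript circle and subscript \<open>A\<close>, and so on; \<open>Mor f\<close> is the generating cell of
  the morphism \<open>f\<close>.\<close>

datatype ('o, 'm) cell_term =
    S_circ 'o
  | R_circ 'o
  | S_bullet 'o
  | R_bullet 'o
  | Mor 'm
  | HId 'o
  | VId "('o \<times> polarity) list"
  | Beside "('o, 'm) cell_term" "('o, 'm) cell_term"
  | Above "('o, 'm) cell_term" "('o, 'm) cell_term"

primrec term_top :: "('o, 'm, 'z) smcat_scheme \<Rightarrow> ('o, 'm) cell_term \<Rightarrow> 'o" where
  "term_top C (S_circ A) = A"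
| "term_top C (R_circ A) = \<one>\<^bsub>ob C\<^esub>"
| "term_top C (S_bullet A) = A"
| "term_top C (R_bullet A) = \<one>\<^bsub>ob C\<^esub>"
| "term_top C (Mor f) = src C f"
| "term_top C (HId A) = A"
| "term_top C (VId X) = \<one>\<^bsub>ob C\<^esub>"
| "term_top C (Beside s t) = term_top C s \<otimes>\<^bsub>ob C\<^esub> term_top C t"
| "term_top C (Above s t) = term_top C s"

primrec term_bot :: "('o, 'm, 'z) smcat_scheme \<Rightarrow> ('o, 'm) cell_term \<Rightarrow> 'o" where
  "term_bot C (S_circ A) = \<one>\<^bsub>ob C\<^esub>"
| "term_bot C (R_circ A) = A"
| "term_bot C (S_bullet A) = \<one>\<^bsub>ob C\<^esub>"
| "term_bot C (R_bullet A) = A"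
| "term_bot C (Mor f) = tgt C f"
| "term_bot C (HId A) = A"
| "term_bot C (VId X) = \<one>\<^bsub>ob C\<^esub>"
| "term_bot C (Beside s t) = term_bot C s \<otimes>\<^bsub>ob C\<^esub> term_bot C t"
| "term_bot C (Above s t) = term_bot C t"

primrec term_left :: "('o, 'm) cell_term \<Rightarrow> ('o \<times> polarity) list" where
  "term_left (S_circ A) = []"
| "term_left (R_circ A) = gen_circ A"
| "term_left (S_bullet A) = gen_bullet A"
| "term_left (R_bullet A) = []"
| "term_left (Mor f) = []"
| "term_left (HId A) = []"
| "term_left (VId X) = X"
| "term_left (Beside s t) = term_left s"
| "term_left (Above s t) = term_left s @ term_left t"

primrec term_right :: "('o, 'm) cell_term \<Rightarrow> ('o \<times> polarity) list" where
  "term_right (S_circ A) = gen_circ A"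
| "term_right (R_circ A) = []"
| "term_right (S_bullet A) = []"
| "term_right (R_bullet A) = gen_bullet A"
| "term_right (Mor f) = []"
| "term_right (HId A) = []"
| "term_right (VId X) = X"
| "term_right (Beside s t) = term_right t"
| "term_right (Above s t) = term_right s @ term_right t"

primrec cell_wf :: "('o, 'm, 'z) smcat_scheme \<Rightarrow> ('o, 'm) cell_term \<Rightarrow> bool" where
  "cell_wf C (S_circ A) \<longleftrightarrow> A \<in> carrier (ob C)"
| "cell_wf C (R_circ A) \<longleftrightarrow> A \<in> carrier (ob C)"
| "cell_wf C (S_bullet A) \<longleftrightarrow> A \<in> carrier (ob C)"
| "cell_wf C (R_bullet A) \<longleftrightarrow> A \<in> carrier (ob C)"
| "cell_wf C (Mor f) \<longleftrightarrow> f \<in> arr C"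
| "cell_wf C (HId A) \<longleftrightarrow> A \<in> carrier (ob C)"
| "cell_wf C (VId X) \<longleftrightarrow> X \<in> lists (carrier (ob C) \<times> UNIV)"
| "cell_wf C (Beside s t) \<longleftrightarrow> cell_wf C s \<and> cell_wf C t \<and> term_right s = term_left t"
| "cell_wf C (Above s t) \<longleftrightarrow> cell_wf C s \<and> cell_wf C t \<and> term_bot C s = term_top C t"

inductive cell_eq ::
  "('o, 'm, 'z) smcat_scheme \<Rightarrow> ('o, 'm) cell_term \<Rightarrow> ('o, 'm) cell_term \<Rightarrow> bool"
  for C :: "('o, 'm, 'z) smcat_scheme"
where
  \<comment> \<open>congruence\<close>
  refl: "cell_wf C s \<Longrightarrow> cell_eq C s s"
| sym: "cell_eq C s t \<Longrightarrow> cell_eq C t s"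
| trans: "\<lbrakk>cell_eq C s t; cell_eq C t u\<rbrakk> \<Longrightarrow> cell_eq C s u"
| Beside_cong: "\<lbrakk>cell_eq C s s'; cell_eq C t t'; term_right s = term_left t\<rbrakk>
    \<Longrightarrow> cell_eq C (Beside s t) (Beside s' t')"
| Above_cong: "\<lbrakk>cell_eq C s s'; cell_eq C t t'; term_bot C s = term_top C t\<rbrakk>
    \<Longrightarrow> cell_eq C (Above s t) (Above s' t')"
  \<comment> \<open>laws of single-object double categories\<close>
| Beside_assoc: "cell_wf C (Beside (Beside s t) u)
    \<Longrightarrow> cell_eq C (Beside (Beside s t) u) (Beside s (Beside t u))"
| Above_assoc: "cell_wf C (Above (Above s t) u)
    \<Longrightarrow> cell_eq C (Above (Above s t) u) (Above s (Above t u))"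
| Beside_VId_left: "cell_wf C s \<Longrightarrow> cell_eq C (Beside (VId (term_left s)) s) s"
| Beside_VId_right: "cell_wf C s \<Longrightarrow> cell_eq C (Beside s (VId (term_right s))) s"
| Above_HId_top: "cell_wf C s \<Longrightarrow> cell_eq C (Above (HId (term_top C s)) s) s"
| Above_HId_bot: "cell_wf C s \<Longrightarrow> cell_eq C (Above s (HId (term_bot C s))) s"
| Beside_HId: "\<lbrakk>A \<in> carrier (ob C); B \<in> carrier (ob C)\<rbrakk>
    \<Longrightarrow> cell_eq C (Beside (HId A) (HId B)) (HId (A \<otimes>\<^bsub>ob C\<^esub> B))"
| Above_VId: "\<lbrakk>X \<in> lists (carrier (ob C) \<times> UNIV); Y \<in> lists (carrier (ob C) \<times> UNIV)\<rbrakk>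
    \<Longrightarrow> cell_eq C (Above (VId X) (VId Y)) (VId (X @ Y))"
| HId_VId: "cell_eq C (HId \<one>\<^bsub>ob C\<^esub>) (VId [])"
| exchange: "\<lbrakk>cell_wf C (Above s t); cell_wf C (Above u v);
      term_right s = term_left u; term_right t = term_left v\<rbrakk>
    \<Longrightarrow> cell_eq C (Beside (Above s t) (Above u v)) (Above (Beside s u) (Beside t v))"
  \<comment> \<open>yanking equations\<close>
| yank_circ_h: "A \<in> carrier (ob C) \<Longrightarrow> cell_eq C (Beside (S_circ A) (R_circ A)) (HId A)"
| yank_circ_v: "A \<in> carrier (ob C) \<Longrightarrow> cell_eq C (Above (R_circ A) (S_circ A)) (VId (gen_circ A))"
| yank_bullet_h: "A \<in> carrier (ob C) \<Longrightarrow> cell_eq C (Beside (R_bullet A) (S_bullet A)) (HId A)"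
| yank_bullet_v: "A \<in> carrier (ob C)
    \<Longrightarrow> cell_eq C (Above (R_bullet A) (S_bullet A)) (VId (gen_bullet A))"
  \<comment> \<open>compatibility with the structure of the base category\<close>
| Mor_cmp: "\<lbrakk>f \<in> arr C; g \<in> arr C; tgt C f = src C g\<rbrakk>
    \<Longrightarrow> cell_eq C (Above (Mor f) (Mor g)) (Mor (cmp C f g))"
| Mor_idt: "A \<in> carrier (ob C) \<Longrightarrow> cell_eq C (Mor (idt C A)) (HId A)"
| Mor_ten: "\<lbrakk>f \<in> arr C; g \<in> arr C\<rbrakk>
    \<Longrightarrow> cell_eq C (Beside (Mor f) (Mor g)) (Mor (ten C f g))"

definition cell_class ::
  "('o, 'm, 'z) smcat_scheme \<Rightarrow> ('o, 'm) cell_term \<Rightarrow> ('o, 'm) cell_term set" where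
  "cell_class C t = {u. cell_eq C t u}"

definition cell_rep :: "('o, 'm) cell_term set \<Rightarrow> ('o, 'm) cell_term" where
  "cell_rep \<alpha> = (SOME t. t \<in> \<alpha>)"

definition free_cornering ::
  "('o, 'm, 'z) smcat_scheme \<Rightarrow> ('o, ('o \<times> polarity) list, ('o, 'm) cell_term set) sodcat" where
  "free_cornering C =
     \<lparr> hedge = ob C,
       vedge = word_monoid (carrier (ob C) \<times> UNIV),
       cells = cell_class C ` {t. cell_wf C t},
       ctop = (\<lambda>\<alpha>. term_top C (cell_rep \<alpha>)),
       cbot = (\<lambda>\<alpha>. term_bot C (cell_rep \<alpha>)),
       cleft = (\<lambda>\<alpha>. term_left (cell_rep \<alpha>)),
       cright = (\<lambda>\<alpha>. term_right (cell_rep \<alpha>)),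
       hcomp = (\<lambda>\<alpha> \<beta>. cell_class C (Beside (cell_rep \<alpha>) (cell_rep \<beta>))),
       vcomp = (\<lambda>\<alpha> \<beta>. cell_class C (Above (cell_rep \<alpha>) (cell_rep \<beta>))),
       hid = (\<lambda>A. cell_class C (HId A)),
       vid = (\<lambda>X. cell_class C (VId X)) \<rparr>"

abbreviation H_cornering ::
  "('o, 'm, 'z) smcat_scheme \<Rightarrow> (('o \<times> polarity) list, ('o, 'm) cell_term set) smcat" where
  "H_cornering C \<equiv> horizontal_cells (free_cornering C)"

context strict_monoidal_category
begin

lemma term_bounds_closed:
  assumes "cell_wf C t"
  shows "term_top C t \<in> carrier (ob C)" "term_bot C t \<in> carrier (ob C)"
    "term_left t \<in> lists (carrier (ob C) \<times> UNIV)" "term_right t \<in> lists (carrier (ob C) \<times> UNIV)"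
proof -
  interpret M: monoid "ob C" by (rule ob_monoid)
  show "term_top C t \<in> carrier (ob C)" "term_bot C t \<in> carrier (ob C)"
    "term_left t \<in> lists (carrier (ob C) \<times> UNIV)" "term_right t \<in> lists (carrier (ob C) \<times> UNIV)"
    using assms by (induction t) (auto simp: src_closed tgt_closed)
qed

lemma cell_eq_bounds:
  assumes "cell_eq C s t"
  shows "cell_wf C s \<and> cell_wf C t \<and> term_top C s = term_top C t \<and> term_bot C s = term_bot C t \<and>
    term_left s = term_left t \<and> term_right s = term_right t"
proof -
  interpret M: monoid "ob C" by (rule ob_monoid)
  show ?thesis
    using assms
    by induction
      (auto simp: term_bounds_closed M.m_assoc src_idt tgt_idt src_cmp tgt_cmp src_ten tgt_ten
        idt_closed cmp_closed ten_closed)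
qed

lemma cell_class_eq_iff:
  "cell_wf C s \<Longrightarrow> cell_class C s = cell_class C t \<longleftrightarrow> cell_eq C s t"
  unfolding cell_class_def by (auto intro: cell_eq.intros)

lemma cell_rep_class:
  assumes "cell_wf C t"
  shows "cell_eq C t (cell_rep (cell_class C t))"
  using someI[of "cell_eq C t" t] cell_eq.refl[OF assms]
  unfolding cell_rep_def cell_class_def by simp

lemma cell_rep_simps:
  assumes "cell_wf C t"
  shows "cell_wf C (cell_rep (cell_class C t))"
    "term_top C (cell_rep (cell_class C t)) = term_top C t"
    "term_bot C (cell_rep (cell_class C t)) = term_bot C t"
    "term_left (cell_rep (cell_class C t)) = term_left t"
    "term_right (cell_rep (cell_class C t)) = term_right t"
  using cell_eq_bounds[OF cell_rep_class[OF assms]] by auto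

lemma class_Beside:
  assumes "cell_wf C (Beside s t)"
  shows "cell_class C (Beside (cell_rep (cell_class C s)) (cell_rep (cell_class C t)))
    = cell_class C (Beside s t)"
proof -
  have "cell_eq C (Beside s t) (Beside (cell_rep (cell_class C s)) (cell_rep (cell_class C t)))"
    using assms by (auto intro!: cell_eq.Beside_cong cell_rep_class)
  with assms show ?thesis by (metis cell_class_eq_iff)
qed

lemma class_Above:
  assumes "cell_wf C (Above s t)"
  shows "cell_class C (Above (cell_rep (cell_class C s)) (cell_rep (cell_class C t)))
    = cell_class C (Above s t)"
proof -
  have "cell_eq C (Above s t) (Above (cell_rep (cell_class C s)) (cell_rep (cell_class C t)))"
    using assms by (auto intro!: cell_eq.Above_cong cell_rep_class)
  with assms show ?thesis by (metis cell_class_eq_iff)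
qed

theorem single_object_double_category_free_cornering:
  "single_object_double_category (free_cornering C)"
proof -
  interpret M: monoid "ob C" by (rule ob_monoid)
  have eqI: "cell_class C s = cell_class C t" if "cell_eq C s t" for s t
    using that cell_class_eq_iff cell_eq_bounds by blast
  note rules = term_bounds_closed cell_rep_simps class_Beside class_Above
  have word_closed: "a \<in> carrier (ob C)"
    if "(a, p) \<in> set (term_left t) \<or> (a, p) \<in> set (term_right t)" "cell_wf C t" for a p t
    using that term_bounds_closed(3,4)[OF that(2)] by auto
  show ?thesis
    unfolding single_object_double_category_def free_cornering_def word_monoid_def
    apply (simp add: ob_monoid, intro conjI)
    subgoal by (simp add: monoid_def)
    subgoal by (auto simp: rules intro: word_closed)
    subgoal by (auto simp: rules)
    subgoal by (auto simp: rules)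
    subgoal by (auto simp: rules)
    subgoal by (auto simp: rules)
    subgoal by (auto simp: rules eqI[OF cell_eq.Beside_assoc])
    subgoal by (auto simp: rules eqI[OF cell_eq.Above_assoc])
    subgoal by (auto simp: rules eqI[OF cell_eq.Beside_VId_left] intro: word_closed)
    subgoal by (auto simp: rules eqI[OF cell_eq.Beside_VId_right] intro: word_closed)
    subgoal by (auto simp: rules eqI[OF cell_eq.Above_HId_top])
    subgoal by (auto simp: rules eqI[OF cell_eq.Above_HId_bot])
    subgoal by (auto simp: rules eqI[OF cell_eq.Beside_HId])
    subgoal by (auto simp: rules eqI[OF cell_eq.Above_VId])
    subgoal by (auto simp: rules eqI[OF cell_eq.HId_VId])
    subgoal by (auto simp: rules eqI[OF cell_eq.exchange])
    done
qed

end

end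

(* Call a vertical edge X a companion of a horizontal edge A if there are cells s (top A, right X)
   and r (left X, bottom A) satisfying the two yanking equations.  Two companions X, Y of the same A
   are isomorphic, by stacking the r of X on the s of Y.  Companions can be transported along
   vertical isomorphisms, the unit is a companion of the unit, and if X, Y are companions of A, B
   then the product of X and Y is a companion of the product of B and A, in this reversed order.
   The corners make each circle generator a companion of its object; the reversal is undone by the
   symmetry, which is a vertical isomorphism.  The bullet generators are companions in the
   double category reflected left to right. *)

theory Submission
  imports Defs
begin

section \<open>Companions and vertical isomorphisms\<close>

definition companion :: "('h, 'v, 'c, 'z) sodcat_scheme \<Rightarrow> 'v \<Rightarrow> 'h \<Rightarrow> bool" where
  "companion D X A \<longleftrightarrow>
     X \<in> carrier (vedge D) \<and> A \<in> carrier (hedge D) \<and>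
     (\<exists>s\<in>cells D. \<exists>r\<in>cells D.
        ctop D s = A \<and> cbot D s = \<one>\<^bsub>hedge D\<^esub> \<and> cleft D s = \<one>\<^bsub>vedge D\<^esub> \<and> cright D s = X \<and>
        ctop D r = \<one>\<^bsub>hedge D\<^esub> \<and> cbot D r = A \<and> cleft D r = X \<and> cright D r = \<one>\<^bsub>vedge D\<^esub> \<and>
        hcomp D s r = hid D A \<and> vcomp D r s = vid D X)"

text \<open>This is isomorphism in the category of vertical cells, the counterpart of
  \<open>horizontal_cells\<close> with the two directions exchanged.\<close>

definition vertically_isomorphic :: "('h, 'v, 'c, 'z) sodcat_scheme \<Rightarrow> 'h \<Rightarrow> 'h \<Rightarrow> bool" where
  "vertically_isomorphic D A B \<longleftrightarrow>
     A \<in> carrier (hedge D) \<and> B \<in> carrier (hedge D) \<and>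
     (\<exists>f\<in>cells D. \<exists>g\<in>cells D.
        ctop D f = A \<and> cbot D f = B \<and> cleft D f = \<one>\<^bsub>vedge D\<^esub> \<and> cright D f = \<one>\<^bsub>vedge D\<^esub> \<and>
        ctop D g = B \<and> cbot D g = A \<and> cleft D g = \<one>\<^bsub>vedge D\<^esub> \<and> cright D g = \<one>\<^bsub>vedge D\<^esub> \<and>
        vcomp D f g = hid D A \<and> vcomp D g f = hid D B)"

lemma companionI:
  assumes "X \<in> carrier (vedge D)" "A \<in> carrier (hedge D)" "s \<in> cells D" "r \<in> cells D"
    and "ctop D s = A" "cbot D s = \<one>\<^bsub>hedge D\<^esub>" "cleft D s = \<one>\<^bsub>vedge D\<^esub>" "cright D s = X"
    and "ctop D r = \<one>\<^bsub>hedge D\<^esub>" "cbot D r = A" "cleft D r = X" "cright D r = \<one>\<^bsub>vedge D\<^esub>"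
    and "hcomp D s r = hid D A" "vcomp D r s = vid D X"
  shows "companion D X A"
  using assms unfolding companion_def by blast

lemma vertically_isomorphicI:
  assumes "A \<in> carrier (hedge D)" "B \<in> carrier (hedge D)" "f \<in> cells D" "g \<in> cells D"
    and "ctop D f = A" "cbot D f = B" "cleft D f = \<one>\<^bsub>vedge D\<^esub>" "cright D f = \<one>\<^bsub>vedge D\<^esub>"
    and "ctop D g = B" "cbot D g = A" "cleft D g = \<one>\<^bsub>vedge D\<^esub>" "cright D g = \<one>\<^bsub>vedge D\<^esub>"
    and "vcomp D f g = hid D A" "vcomp D g f = hid D B"
  shows "vertically_isomorphic D A B"
  using assms unfolding vertically_isomorphic_def by blast

lemma isomorphic_objectsI:
  assumes "X \<in> carrier (ob C)" "Y \<in> carrier (ob C)" "f \<in> arr C" "g \<in> arr C"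
    and "src C f = X" "tgt C f = Y" "src C g = Y" "tgt C g = X"
    and "cmp C f g = idt C X" "cmp C g f = idt C Y"
  shows "isomorphic_objects C X Y"
  using assms unfolding isomorphic_objects_def by blast

section \<open>Companions in an arbitrary single-object double category\<close>

context single_object_double_category
begin

interpretation H: monoid "hedge D" by (rule hedge_monoid)
interpretation V: monoid "vedge D" by (rule vedge_monoid)

lemmas cell_simps = bound_closed hcomp_cell vcomp_cell hid_cell vid_cell

lemma hcomp_hid_unit:
  assumes "\<alpha> \<in> cells D"
  shows "cleft D \<alpha> = \<one>\<^bsub>vedge D\<^esub> \<Longrightarrow> hcomp D (hid D \<one>\<^bsub>hedge D\<^esub>) \<alpha> = \<alpha>"
    and "cright D \<alpha> = \<one>\<^bsub>vedge D\<^esub> \<Longrightarrow> hcomp D \<alpha> (hid D \<one>\<^bsub>hedge D\<^esub>) = \<alpha>"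
  using hcomp_vid_left[OF assms] hcomp_vid_right[OF assms] by (simp_all add: hid_vid_unit)

text \<open>Identity cells on the unit pad the two columns to height three, with rows (\<alpha>,
  identity), (\<beta>, \<gamma>), (identity, \<delta>); two interchanges then read the grid by rows.
  The purpose is to bring two corners side by side in the middle row, where they can be yanked
  straight.\<close>

lemma hcomp_staircase:
  assumes "\<alpha> \<in> cells D" "\<beta> \<in> cells D" "\<gamma> \<in> cells D" "\<delta> \<in> cells D"
    and "cright D \<alpha> = \<one>\<^bsub>vedge D\<^esub>" "cleft D \<delta> = \<one>\<^bsub>vedge D\<^esub>" "cright D \<beta> = cleft D \<gamma>"
    and "cbot D \<alpha> = ctop D \<beta>" "cbot D \<beta> = \<one>\<^bsub>hedge D\<^esub>" "ctop D \<gamma> = \<one>\<^bsub>hedge D\<^esub>" "cbot D \<gamma> = ctop D \<delta>"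
  shows "hcomp D (vcomp D \<alpha> \<beta>) (vcomp D \<gamma> \<delta>) = vcomp D (vcomp D \<alpha> (hcomp D \<beta> \<gamma>)) \<delta>"
proof -
  let ?I = "hid D \<one>\<^bsub>hedge D\<^esub>"
  have "hcomp D (vcomp D \<alpha> \<beta>) (vcomp D \<gamma> \<delta>)
      = hcomp D (vcomp D (vcomp D \<alpha> \<beta>) ?I) (vcomp D (vcomp D ?I \<gamma>) \<delta>)"
    using vcomp_hid_bot[of "vcomp D \<alpha> \<beta>"] vcomp_hid_top[of \<gamma>] assms by (simp add: cell_simps)
  also have "\<dots> = vcomp D (hcomp D (vcomp D \<alpha> \<beta>) (vcomp D ?I \<gamma>)) (hcomp D ?I \<delta>)"
    using assms by (intro interchange) (simp_all add: cell_simps)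
  also have "hcomp D (vcomp D \<alpha> \<beta>) (vcomp D ?I \<gamma>) = vcomp D (hcomp D \<alpha> ?I) (hcomp D \<beta> \<gamma>)"
    using assms by (intro interchange) (simp_all add: cell_simps)
  finally show ?thesis
    using assms by (simp add: hcomp_hid_unit)
qed

text \<open>An Eckmann-Hilton argument: in the two-by-two grid with \<beta> at the top right,
  \<alpha> at the bottom left and identities elsewhere, reading by columns gives one side and
  reading by rows the other.\<close>

lemma hcomp_eq_vcomp_swap:
  assumes "\<alpha> \<in> cells D" "\<beta> \<in> cells D"
    and "cright D \<alpha> = \<one>\<^bsub>vedge D\<^esub>" "cleft D \<beta> = \<one>\<^bsub>vedge D\<^esub>"
    and "ctop D \<alpha> = \<one>\<^bsub>hedge D\<^esub>" "cbot D \<beta> = \<one>\<^bsub>hedge D\<^esub>"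
  shows "hcomp D \<alpha> \<beta> = vcomp D \<beta> \<alpha>"
proof -
  let ?I = "hid D \<one>\<^bsub>hedge D\<^esub>"
  have "hcomp D \<alpha> \<beta> = hcomp D (vcomp D ?I \<alpha>) (vcomp D \<beta> ?I)"
    using vcomp_hid_top[of \<alpha>] vcomp_hid_bot[of \<beta>] assms by simp
  also have "\<dots> = vcomp D (hcomp D ?I \<beta>) (hcomp D \<alpha> ?I)"
    using assms by (intro interchange) (simp_all add: cell_simps)
  finally show ?thesis
    using assms by (simp add: hcomp_hid_unit)
qed

lemma companion_unit: "companion D \<one>\<^bsub>vedge D\<^esub> \<one>\<^bsub>hedge D\<^esub>"
proof -
  \<comment> \<open>One cell serves as both corners, because \<open>hid\<close> and
    \<open>vid\<close> agree on the units.\<close>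
  let ?I = "hid D \<one>\<^bsub>hedge D\<^esub>"
  have "?I \<in> cells D" "vcomp D ?I ?I = vid D \<one>\<^bsub>vedge D\<^esub>"
    using vcomp_vid[OF V.one_closed V.one_closed] by (simp_all add: cell_simps hid_vid_unit)
  then show ?thesis
    by (intro companionI[of _ _ _ ?I ?I]) (simp_all add: cell_simps hcomp_hid)
qed

lemma companion_transport:
  assumes "companion D X A" "vertically_isomorphic D A B"
  shows "companion D X B"
proof -
  obtain s r where sr: "s \<in> cells D" "r \<in> cells D"
      "ctop D s = A" "cbot D s = \<one>\<^bsub>hedge D\<^esub>" "cleft D s = \<one>\<^bsub>vedge D\<^esub>" "cright D s = X"
      "ctop D r = \<one>\<^bsub>hedge D\<^esub>" "cbot D r = A" "cleft D r = X" "cright D r = \<one>\<^bsub>vedge D\<^esub>"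
      "hcomp D s r = hid D A" "vcomp D r s = vid D X"
    and X: "X \<in> carrier (vedge D)"
    using assms(1) unfolding companion_def by blast
  obtain f g where fg: "f \<in> cells D" "g \<in> cells D"
      "ctop D f = A" "cbot D f = B" "cleft D f = \<one>\<^bsub>vedge D\<^esub>" "cright D f = \<one>\<^bsub>vedge D\<^esub>"
      "ctop D g = B" "cbot D g = A" "cleft D g = \<one>\<^bsub>vedge D\<^esub>" "cright D g = \<one>\<^bsub>vedge D\<^esub>"
      "vcomp D f g = hid D A" "vcomp D g f = hid D B"
    and AB: "A \<in> carrier (hedge D)" "B \<in> carrier (hedge D)"
    using assms(2) unfolding vertically_isomorphic_def by blast
  \<comment> \<open>The new corners pass through the isomorphism: \<open>g\<close> above
    \<open>s\<close>, and \<open>r\<close> above \<open>f\<close>. Side by side they form a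
    staircase whose middle row is yanked to the identity on \<open>A\<close>, leaving
    \<open>g\<close> above \<open>f\<close>.\<close>
  have "hcomp D (vcomp D g s) (vcomp D r f) = vcomp D (vcomp D g (hid D A)) f"
    using sr fg by (simp add: hcomp_staircase)
  then have h: "hcomp D (vcomp D g s) (vcomp D r f) = hid D B"
    using fg vcomp_hid_bot[of g] by simp
  \<comment> \<open>Stacked the other way, \<open>f\<close> and \<open>g\<close> meet and cancel
    between \<open>r\<close> and \<open>s\<close>.\<close>
  have "vcomp D (vcomp D r f) (vcomp D g s) = vcomp D r (vcomp D (vcomp D f g) s)"
    using sr(1-10) fg(1-10) by (simp add: vcomp_assoc cell_simps)
  then have v: "vcomp D (vcomp D r f) (vcomp D g s) = vid D X"
    using sr fg vcomp_hid_top[of s] by simp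
  show ?thesis
    by (rule companionI[of _ _ _ "vcomp D g s" "vcomp D r f"])
      (simp_all add: sr fg X AB h v cell_simps)
qed

text \<open>A strand entering from above can leave to the right only if nothing stands to its right.
  So the strand of \<open>A\<close>, to the right of \<open>B\<close>, bends first and yields the
  upper factor \<open>X\<close>; this accounts for the reversed order.\<close>

lemma companion_mult:
  assumes "companion D X A" "companion D Y B"
  shows "companion D (X \<otimes>\<^bsub>vedge D\<^esub> Y) (B \<otimes>\<^bsub>hedge D\<^esub> A)"
proof -
  obtain s r where sr: "s \<in> cells D" "r \<in> cells D"
      "ctop D s = A" "cbot D s = \<one>\<^bsub>hedge D\<^esub>" "cleft D s = \<one>\<^bsub>vedge D\<^esub>" "cright D s = X"
      "ctop D r = \<one>\<^bsub>hedge D\<^esub>" "cbot D r = A" "cleft D r = X" "cright D r = \<one>\<^bsub>vedge D\<^esub>"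
      "hcomp D s r = hid D A" "vcomp D r s = vid D X"
    and XA: "X \<in> carrier (vedge D)" "A \<in> carrier (hedge D)"
    using assms(1) unfolding companion_def by blast
  obtain s' r' where sr': "s' \<in> cells D" "r' \<in> cells D"
      "ctop D s' = B" "cbot D s' = \<one>\<^bsub>hedge D\<^esub>" "cleft D s' = \<one>\<^bsub>vedge D\<^esub>" "cright D s' = Y"
      "ctop D r' = \<one>\<^bsub>hedge D\<^esub>" "cbot D r' = B" "cleft D r' = Y" "cright D r' = \<one>\<^bsub>vedge D\<^esub>"
      "hcomp D s' r' = hid D B" "vcomp D r' s' = vid D Y"
    and YB: "Y \<in> carrier (vedge D)" "B \<in> carrier (hedge D)"
    using assms(2) unfolding companion_def by blast
  note typed = sr sr' XA YB cell_simps
  let ?b = "hcomp D (hid D B) s" and ?c = "hcomp D r' (hid D A)"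
  \<comment> \<open>Read by rows, each row contains one horizontal yanking beside an identity:
    \<open>s\<close> with \<open>r\<close> in the upper one, \<open>s'\<close> with
    \<open>r'\<close> in the lower one.\<close>
  have "hcomp D (vcomp D ?b s') (vcomp D r ?c) = vcomp D (hcomp D ?b r) (hcomp D s' ?c)"
    by (intro interchange) (simp_all add: typed)
  also have "hcomp D ?b r = hid D (B \<otimes>\<^bsub>hedge D\<^esub> A)"
    using hcomp_assoc[of "hid D B" s r] by (simp add: typed hcomp_hid)
  also have "hcomp D s' ?c = hid D (B \<otimes>\<^bsub>hedge D\<^esub> A)"
    using hcomp_assoc[of s' r' "hid D A"] by (simp add: typed hcomp_hid)
  finally have h: "hcomp D (vcomp D ?b s') (vcomp D r ?c) = hid D (B \<otimes>\<^bsub>hedge D\<^esub> A)"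
    using vcomp_hid_top[of "hid D (B \<otimes>\<^bsub>hedge D\<^esub> A)"] by (simp add: typed)
  \<comment> \<open>The vertical equation needs \<open>r\<close> next to \<open>s\<close> and
    \<open>r'\<close> next to \<open>s'\<close>, but \<open>r'\<close> and \<open>s\<close> occur in
    the wrong order. The middle of the stack equals \<open>r'\<close> beside \<open>s\<close>, and
    these slide past each other to become \<open>s\<close> above \<open>r'\<close>.\<close>
  have "vcomp D ?c ?b = hcomp D (vcomp D r' (hid D B)) (vcomp D (hid D A) s)"
    by (rule interchange[symmetric]) (simp_all add: typed)
  also have "\<dots> = vcomp D s r'"
    using vcomp_hid_bot[of r'] vcomp_hid_top[of s] by (simp add: typed hcomp_eq_vcomp_swap)
  finally have mid: "vcomp D ?c ?b = vcomp D s r'" .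
  have "vcomp D (vcomp D r ?c) (vcomp D ?b s') = vcomp D (vcomp D r (vcomp D ?c ?b)) s'"
    by (simp add: typed vcomp_assoc)
  also have "\<dots> = vcomp D (vcomp D r s) (vcomp D r' s')"
    unfolding mid using sr(1-10) sr'(1-10) by (simp add: vcomp_assoc vcomp_cell)
  finally have v: "vcomp D (vcomp D r ?c) (vcomp D ?b s') = vid D (X \<otimes>\<^bsub>vedge D\<^esub> Y)"
    by (simp add: typed vcomp_vid)
  show ?thesis
    by (rule companionI[of _ _ _ "vcomp D ?b s'" "vcomp D r ?c"]) (simp_all add: typed h v)
qed

lemma isomorphic_companions:
  assumes "companion D X A" "companion D Y A"
  shows "isomorphic_objects (horizontal_cells D) X Y"
proof -
  obtain s r where sr: "s \<in> cells D" "r \<in> cells D"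
      "ctop D s = A" "cbot D s = \<one>\<^bsub>hedge D\<^esub>" "cleft D s = \<one>\<^bsub>vedge D\<^esub>" "cright D s = X"
      "ctop D r = \<one>\<^bsub>hedge D\<^esub>" "cbot D r = A" "cleft D r = X" "cright D r = \<one>\<^bsub>vedge D\<^esub>"
      "hcomp D s r = hid D A" "vcomp D r s = vid D X"
    and X: "X \<in> carrier (vedge D)"
    using assms(1) unfolding companion_def by blast
  obtain s' r' where sr': "s' \<in> cells D" "r' \<in> cells D"
      "ctop D s' = A" "cbot D s' = \<one>\<^bsub>hedge D\<^esub>" "cleft D s' = \<one>\<^bsub>vedge D\<^esub>" "cright D s' = Y"
      "ctop D r' = \<one>\<^bsub>hedge D\<^esub>" "cbot D r' = A" "cleft D r' = Y" "cright D r' = \<one>\<^bsub>vedge D\<^esub>"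
      "hcomp D s' r' = hid D A" "vcomp D r' s' = vid D Y"
    and Y: "Y \<in> carrier (vedge D)"
    using assms(2) unfolding companion_def by blast
  \<comment> \<open>The middle row of this staircase is \<open>s'\<close> beside \<open>r'\<close>,
    the identity on \<open>A\<close>. What remains is \<open>r\<close> above \<open>s\<close>, the
    other yanking equation.\<close>
  have fg: "hcomp D (vcomp D r s') (vcomp D r' s) = vid D X"
    using sr sr' vcomp_hid_bot[of r] by (simp add: hcomp_staircase)
  have gf: "hcomp D (vcomp D r' s) (vcomp D r s') = vid D Y"
    using sr sr' vcomp_hid_bot[of r'] by (simp add: hcomp_staircase)
  show ?thesis
    by (rule isomorphic_objectsI[of _ _ _ "vcomp D r s'" "vcomp D r' s"])
      (simp_all add: horizontal_cells_def sr sr' X Y fg gf cell_simps)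
qed

end

section \<open>Reflection left to right\<close>

definition mirror :: "('h, 'v, 'c, 'z) sodcat_scheme \<Rightarrow> ('h, 'v, 'c) sodcat" where
  "mirror D =
     \<lparr> hedge = \<lparr>carrier = carrier (hedge D), mult = (\<lambda>A B. B \<otimes>\<^bsub>hedge D\<^esub> A), one = \<one>\<^bsub>hedge D\<^esub>\<rparr>,
       vedge = vedge D,
       cells = cells D,
       ctop = ctop D,
       cbot = cbot D,
       cleft = cright D,
       cright = cleft D,
       hcomp = (\<lambda>\<alpha> \<beta>. hcomp D \<beta> \<alpha>),
       vcomp = vcomp D,
       hid = hid D,
       vid = vid D \<rparr>"

text \<open>Reversing horizontal composition also reverses the products of top and bottom
  boundaries, so the horizontal edge monoid has to be replaced by its opposite. Vertical products
  keep their order.\<close>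

lemma (in single_object_double_category) single_object_double_category_mirror:
  "single_object_double_category (mirror D)"
proof -
  interpret H: monoid "hedge D" by (rule hedge_monoid)
  interpret V: monoid "vedge D" by (rule vedge_monoid)
  show ?thesis
    by unfold_locales
      (auto simp: mirror_def cell_simps hcomp_assoc vcomp_assoc hcomp_vid_left hcomp_vid_right
        vcomp_hid_top vcomp_hid_bot hcomp_hid vcomp_vid hid_vid_unit interchange H.m_assoc V.m_assoc)
qed

text \<open>Reflection replaces the category of horizontal cells by its opposite, and an isomorphism
  there is an inverse isomorphism here.\<close>

lemma isomorphic_objects_mirror:
  "isomorphic_objects (horizontal_cells (mirror D)) X Y \<longleftrightarrow>
     isomorphic_objects (horizontal_cells D) X Y"
  unfolding isomorphic_objects_def horizontal_cells_def mirror_def by auto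

lemma vertically_isomorphic_mirror:
  "vertically_isomorphic (mirror D) A B \<longleftrightarrow> vertically_isomorphic D A B"
  unfolding vertically_isomorphic_def mirror_def by auto

section \<open>Companions and vertical isomorphisms in the free cornering\<close>

context strict_monoidal_category
begin

lemma cell_class_eqI: "cell_eq C s t \<Longrightarrow> cell_class C s = cell_class C t"
  using cell_class_eq_iff cell_eq_bounds by blast

lemma companion_gen_circ:
  assumes "A \<in> carrier (ob C)"
  shows "companion (free_cornering C) (gen_circ A) A"
  by (rule companionI[of _ _ _ "cell_class C (S_circ A)" "cell_class C (R_circ A)"])
    (use assms in \<open>simp_all add: free_cornering_def word_monoid_def cell_rep_simps class_Beside
      class_Above cell_class_eqI cell_eq.yank_circ_h cell_eq.yank_circ_v\<close>)

text \<open>\<open>S_bullet\<close> has its word on the left and the bullet yanking puts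
  \<open>R_bullet\<close> before \<open>S_bullet\<close>. Reflection corrects both, so the bullet
  corners take the form of the circle corners.\<close>

lemma companion_mirror_gen_bullet:
  assumes "A \<in> carrier (ob C)"
  shows "companion (mirror (free_cornering C)) (gen_bullet A) A"
  by (rule companionI[of _ _ _ "cell_class C (S_bullet A)" "cell_class C (R_bullet A)"])
    (use assms in \<open>simp_all add: mirror_def free_cornering_def word_monoid_def cell_rep_simps class_Beside
      class_Above cell_class_eqI cell_eq.yank_bullet_h cell_eq.yank_bullet_v\<close>)

text \<open>\<open>Mor\<close> respects composites and identities, hence carries inverse pairs to
  inverse pairs.\<close>

lemma vertically_isomorphic_free_cornering:
  assumes "f \<in> arr C" "g \<in> arr C" "src C f = A" "tgt C f = B" "src C g = B" "tgt C g = A"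
    and "cmp C f g = idt C A" "cmp C g f = idt C B"
  shows "vertically_isomorphic (free_cornering C) A B"
proof -
  have AB: "A \<in> carrier (ob C)" "B \<in> carrier (ob C)"
    using assms src_closed tgt_closed by auto
  have "cell_eq C (Above (Mor f) (Mor g)) (HId A)" "cell_eq C (Above (Mor g) (Mor f)) (HId B)"
    using cell_eq.Mor_cmp[of f C g] cell_eq.Mor_cmp[of g C f] cell_eq.Mor_idt[of _ C] assms AB
    by (metis cell_eq.trans)+
  then show ?thesis
    by (intro vertically_isomorphicI[of _ _ _ "cell_class C (Mor f)" "cell_class C (Mor g)"])
      (use assms AB in \<open>simp_all add: free_cornering_def word_monoid_def cell_rep_simps class_Above
        cell_class_eqI\<close>)
qed

end

lemma (in symmetric_strict_monoidal_category) vertically_isomorphic_braid: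
  assumes "A \<in> carrier (ob C)" "B \<in> carrier (ob C)"
  shows "vertically_isomorphic (free_cornering C) (A \<otimes>\<^bsub>ob C\<^esub> B) (B \<otimes>\<^bsub>ob C\<^esub> A)"
  using assms
  by (intro vertically_isomorphic_free_cornering[of "braid C A B" "braid C B A"])
    (simp_all add: braid_closed src_braid tgt_braid braid_symmetric)

theorem lemma6p3:
  fixes \<A> :: "('o, 'm) ssmcat" and A B :: 'o
  assumes "symmetric_strict_monoidal_category \<A>"
    and "A \<in> carrier (ob \<A>)" and "B \<in> carrier (ob \<A>)"
  shows "(isomorphic_objects (H_cornering \<A>) (gen_circ \<one>\<^bsub>ob \<A>\<^esub>) \<one>\<^bsub>ob (H_cornering \<A>)\<^esub> \<and>
          isomorphic_objects (H_cornering \<A>) \<one>\<^bsub>ob (H_cornering \<A>)\<^esub> (gen_bullet \<one>\<^bsub>ob \<A>\<^esub>)) \<and>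
         (isomorphic_objects (H_cornering \<A>) (gen_circ A \<otimes>\<^bsub>ob (H_cornering \<A>)\<^esub> gen_circ B)
            (gen_circ B \<otimes>\<^bsub>ob (H_cornering \<A>)\<^esub> gen_circ A) \<and>
          isomorphic_objects (H_cornering \<A>) (gen_bullet A \<otimes>\<^bsub>ob (H_cornering \<A>)\<^esub> gen_bullet B)
            (gen_bullet B \<otimes>\<^bsub>ob (H_cornering \<A>)\<^esub> gen_bullet A)) \<and>
         (isomorphic_objects (H_cornering \<A>) (gen_circ (A \<otimes>\<^bsub>ob \<A>\<^esub> B))
            (gen_circ A \<otimes>\<^bsub>ob (H_cornering \<A>)\<^esub> gen_circ B) \<and>
          isomorphic_objects (H_cornering \<A>) (gen_bullet (A \<otimes>\<^bsub>ob \<A>\<^esub> B))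
            (gen_bullet A \<otimes>\<^bsub>ob (H_cornering \<A>)\<^esub> gen_bullet B))"
proof -
  interpret S: symmetric_strict_monoidal_category \<A> by (rule assms(1))
  interpret M: monoid "ob \<A>" by (rule S.ob_monoid)
  let ?D = "free_cornering \<A>"
  interpret D: single_object_double_category ?D
    by (rule S.single_object_double_category_free_cornering)
  interpret D': single_object_double_category "mirror ?D"
    by (rule D.single_object_double_category_mirror)
  let ?V = "ob (H_cornering \<A>)"
  have vedge: "vedge ?D = ?V" "vedge (mirror ?D) = ?V"
    and hedge: "hedge ?D = ob \<A>"
    and mirror_hedge: "\<And>P Q. P \<otimes>\<^bsub>hedge (mirror ?D)\<^esub> Q = Q \<otimes>\<^bsub>ob \<A>\<^esub> P"
      "\<one>\<^bsub>hedge (mirror ?D)\<^esub> = \<one>\<^bsub>ob \<A>\<^esub>"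
    by (simp_all add: horizontal_cells_def mirror_def free_cornering_def)
  \<comment> \<open>\<open>companion_mult\<close> yields the reversed product \<open>Q\<close>,
    \<open>P\<close>; transport along the braiding gives the other order.\<close>
  have circ: "companion ?D (gen_circ P \<otimes>\<^bsub>?V\<^esub> gen_circ Q) (P \<otimes>\<^bsub>ob \<A>\<^esub> Q)"
      "companion ?D (gen_circ P \<otimes>\<^bsub>?V\<^esub> gen_circ Q) (Q \<otimes>\<^bsub>ob \<A>\<^esub> P)"
    if "P \<in> carrier (ob \<A>)" "Q \<in> carrier (ob \<A>)" for P Q
    using D.companion_mult[OF S.companion_gen_circ S.companion_gen_circ, OF that]
      D.companion_transport S.vertically_isomorphic_braid[OF that(2,1)]
    by (auto simp: vedge hedge)
  \<comment> \<open>Here the reversal in \<open>companion_mult\<close> meets the opposite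
    multiplication of the mirror and cancels, so the product \<open>P\<close>, \<open>Q\<close>
    comes directly and the braiding supplies the reversed one.\<close>
  have bullet: "companion (mirror ?D) (gen_bullet P \<otimes>\<^bsub>?V\<^esub> gen_bullet Q) (P \<otimes>\<^bsub>ob \<A>\<^esub> Q)"
      "companion (mirror ?D) (gen_bullet P \<otimes>\<^bsub>?V\<^esub> gen_bullet Q) (Q \<otimes>\<^bsub>ob \<A>\<^esub> P)"
    if "P \<in> carrier (ob \<A>)" "Q \<in> carrier (ob \<A>)" for P Q
    using D'.companion_mult[OF S.companion_mirror_gen_bullet S.companion_mirror_gen_bullet, OF that]
      D'.companion_transport S.vertically_isomorphic_braid[OF that]
    by (auto simp: vedge mirror_hedge vertically_isomorphic_mirror)
  note iso = D.isomorphic_companions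
    D'.isomorphic_companions[unfolded isomorphic_objects_mirror]
  have unit: "companion ?D \<one>\<^bsub>?V\<^esub> \<one>\<^bsub>ob \<A>\<^esub>" "companion (mirror ?D) \<one>\<^bsub>?V\<^esub> \<one>\<^bsub>ob \<A>\<^esub>"
    using D.companion_unit D'.companion_unit by (simp_all add: vedge hedge mirror_hedge)
  \<comment> \<open>Each claim compares two companions of one object: of the unit in 1, of the
    product of \<open>A\<close> and \<open>B\<close> in 2 and 3. In 2 the word with \<open>B\<close>
    first is handled by the second of the two facts, with \<open>P\<close> and \<open>Q\<close>
    taken as \<open>B\<close> and \<open>A\<close>.\<close>
  show ?thesis
    using assms(2,3)
    by (intro conjI iso(1)[OF S.companion_gen_circ unit(1)]
        iso(2)[OF unit(2) S.companion_mirror_gen_bullet]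
        iso(1)[OF circ(1) circ(2)] iso(2)[OF bullet(1) bullet(2)]
        iso(1)[OF S.companion_gen_circ circ(1)] iso(2)[OF S.companion_mirror_gen_bullet bullet(1)])
      simp_all
qed

end
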